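(* Let $\mathfrak g$ be a simple Lie algebra, $\sigma$ an involution of $\mathfrak g$, and $\mathfrak g=\mathfrak g_0\oplus\mathfrak g_1$ the corresponding $\mathbb Z_2$-grading. Then the eigenvalue $\gamma_{\mathsf{Spin}(\mathfrak g_1)}$ of the Casimir element $\mathcal C_0$ on the $\mathfrak g_0$-module $\mathsf{Spin}(\mathfrak g_1)$ is $$\gamma_{\mathsf{Spin}(\mathfrak g_1)}=\frac{\dim\mathfrak g_1}{16}.$$
   Context: The ground field is algebraically closed of characteristic $0$. An involution $\sigma$ is a Lie algebra automorphism of order $2$ (inner or outer); $\mathfrak g_0$ and $\mathfrak g_1$ are its $(+1)$- and $(-1)$-eigenspaces. $\Phi$ is the Killing form of $\mathfrak g$, and $\mathcal C_0=\sum_j e'_je_j\in\mathcal U(\mathfrak g_0)$ is the Casimir element defined by bases $\{e_j\},\{e'_j\}$ of $\mathfrak g_0$ dual with respect to $\Phi|_{\mathfrak g_0}$. The $\mathfrak g_0$-module $\mathfrak g_1$ is orthogonal via $\Phi|_{\mathfrak g_1}$, which gives a homomorphism $\mathfrak g_0\to\mathfrak{so}(\mathfrak g_1)$. For an orthogonal module $V$, $\mathsf{Spin}(V)$ denotes the restriction to the given Lie algebra of the spinor representation of $\mathfrak{so}(V)$ (the full spinor representation of dimension $2^{[\dim V/2]}$, i.e. the sum of both half-spinor representations when $\dim V$ is even). It satisfies $\bigwedge^\bullet V\simeq \mathsf{Spin}(V)\otimes\mathsf{Spin}(V)$ if $\dim V$ is even and $\bigwedge^\bullet V\simeq 2\,(\mathsf{Spin}(V)\otimes\mathsf{Spin}(V))$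 if $\dim V$ is odd. It is a known fact that $\mathcal C_0$ acts on $\mathsf{Spin}(\mathfrak g_1)$ as a scalar, and this scalar is equal to $(\rho,\rho)-(\rho_0,\rho_0)$, where $\rho$ and $\rho_0$ are the half-sums of positive roots of $\mathfrak g$ and $\mathfrak g_0$ (with respect to Cartan subalgebras $\mathfrak t_0\subset\mathfrak g_0$, $\mathfrak t\subset\mathfrak g$ with $\mathfrak t_0\subset\mathfrak t$, so that $\mathfrak t_0^*\subset\mathfrak t^*$) and $(\ ,\ )$ is the form on $\mathfrak t^*$ induced by $\Phi|_{\mathfrak t}$; it is denoted $\gamma_{\mathsf{Spin}(\mathfrak g_1)}$. *)

theory Defs
  imports "HOL-Computational_Algebra.Polynomial" "HOL-Library.Function_Algebras"
begin

section \<open>Lie algebras and involutions\<close>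

locale lie_algebra = vector_space scale
  for scale :: "'k::field \<Rightarrow> 'g::ab_group_add \<Rightarrow> 'g" (infixr "*s" 75) +
  fixes bracket :: "'g \<Rightarrow> 'g \<Rightarrow> 'g"
  assumes bracket_add_left: "bracket (x + y) z = bracket x z + bracket y z"
    and bracket_add_right: "bracket x (y + z) = bracket x y + bracket x z"
    and bracket_scale_left: "bracket (a *s x) y = a *s bracket x y"
    and bracket_scale_right: "bracket x (a *s y) = a *s bracket x y"
    and bracket_self: "bracket x x = 0"
    and jacobi: "bracket x (bracket y z) + bracket y (bracket z x) + bracket z (bracket x y) = 0"
begin

definition basis_family :: "'i set \<Rightarrow> ('i \<Rightarrow> 'g) \<Rightarrow> 'g set \<Rightarrow> bool" where
  "basis_family I b U \<longleftrightarrow> inj_on b I \<and> independent (b ` I) \<and> span (b ` I) = U"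

definition dual_bases :: "('g \<Rightarrow> 'g \<Rightarrow> 'k) \<Rightarrow> 'g set \<Rightarrow> 'i set \<Rightarrow> ('i \<Rightarrow> 'g) \<Rightarrow> ('i \<Rightarrow> 'g) \<Rightarrow> bool" where
  "dual_bases B U I e e' \<longleftrightarrow> finite I \<and> basis_family I e U \<and> basis_family I e' U \<and>
     (\<forall>i\<in>I. \<forall>j\<in>I. B (e i) (e' j) = (if i = j then 1 else 0))"

text \<open>\<open>extend_basis {}\<close> is the library's (arbitrarily chosen) basis of the whole space; the
  trace of a linear endomorphism of a finite-dimensional space does not depend on it.\<close>

definition trace :: "('g \<Rightarrow> 'g) \<Rightarrow> 'k" where
  "trace T = (\<Sum>b\<in>extend_basis {}. representation (extend_basis {}) (T b) b)"

definition killing :: "'g \<Rightarrow> 'g \<Rightarrow> 'k" where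
  "killing x y = trace (\<lambda>z. bracket x (bracket y z))"

definition lie_ideal :: "'g set \<Rightarrow> bool" where
  "lie_ideal J \<longleftrightarrow> subspace J \<and> (\<forall>x. \<forall>y\<in>J. bracket x y \<in> J)"

definition involution :: "('g \<Rightarrow> 'g) \<Rightarrow> bool" where
  "involution \<sigma> \<longleftrightarrow> Vector_Spaces.linear scale scale \<sigma> \<and> (\<forall>x y. \<sigma> (bracket x y) = bracket (\<sigma> x) (\<sigma> y)) \<and>
     \<sigma> \<circ> \<sigma> = id \<and> \<sigma> \<noteq> id"

end

locale simple_lie_algebra = lie_algebra +
  assumes finite_dim: "\<exists>B. finite B \<and> span B = UNIV"
    and not_abelian: "\<exists>x y. bracket x y \<noteq> 0"
    and ideals_trivial: "lie_ideal J \<Longrightarrow> J = {0} \<or> J = UNIV"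

definition even_part :: "('g \<Rightarrow> 'g) \<Rightarrow> 'g set" where
  "even_part \<sigma> = {x. \<sigma> x = x}"

definition odd_part :: "('g::uminus \<Rightarrow> 'g) \<Rightarrow> 'g set" where
  "odd_part \<sigma> = {x. \<sigma> x = - x}"

section \<open>The spinor representation\<close>

text \<open>A module \<open>S\<close> over the Clifford algebra of the subspace \<open>V\<close> with the symmetric bilinear
  form \<open>B\<close>, given by the action \<open>c\<close> of the generators. The convention is \<open>v\<^sup>2 = B(v, v)\<close>; rescaling
  \<open>B\<close> amounts to rescaling \<open>c\<close> and does not affect the spinor representation below.\<close>

locale clifford_module =
  vs: vector_space scale + S: vector_space scaleS
  for scale :: "'k::field \<Rightarrow> 'v::ab_group_add \<Rightarrow> 'v" (infixr "*s" 75)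
    and scaleS :: "'k \<Rightarrow> 's::ab_group_add \<Rightarrow> 's" (infixr "*S" 75) +
  fixes V :: "'v set" and B :: "'v \<Rightarrow> 'v \<Rightarrow> 'k" and c :: "'v \<Rightarrow> 's \<Rightarrow> 's"
  assumes subspace_V: "vs.subspace V"
    and linear_c: "v \<in> V \<Longrightarrow> Vector_Spaces.linear scaleS scaleS (c v)"
    and c_add: "u \<in> V \<Longrightarrow> v \<in> V \<Longrightarrow> c (u + v) s = c u s + c v s"
    and c_scale: "v \<in> V \<Longrightarrow> c (a *s v) s = a *S c v s"
    and c_square: "v \<in> V \<Longrightarrow> c v (c v s) = B v v *S s"
begin

text \<open>The subspace of the Clifford algebra (acting on \<open>S\<close>) spanned by the commutators \<open>uv - vu\<close>.
  When \<open>B\<close> is nondegenerate it is a copy of \<open>so(V, B)\<close>, acting on \<open>V\<close> by commutators.\<close>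

definition spin_algebra :: "('s \<Rightarrow> 's) set" where
  "spin_algebra = module.span (\<lambda>a T s. a *S T s)
     {(\<lambda>s. c u (c v s) - c v (c u s)) | u v. u \<in> V \<and> v \<in> V}"

text \<open>The operator on \<open>S\<close> by which \<open>A \<in> so(V, B)\<close> acts: the unique element of the above copy of
  \<open>so(V, B)\<close> whose commutator action on \<open>V\<close> is \<open>A\<close>.\<close>

definition spin :: "('v \<Rightarrow> 'v) \<Rightarrow> 's \<Rightarrow> 's" where
  "spin A = (THE T. T \<in> spin_algebra \<and> (\<forall>v\<in>V. \<forall>s. T (c v s) - c v (T s) = c (A v) s))"

end

text \<open>The full spinor module: a simple Clifford module. Over an algebraically closed field of
  characteristic 0 and for nondegenerate \<open>B\<close>, a nonzero Clifford module is simple iff it has the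
  stated dimension. It is unique up to isomorphism if \<open>dim V\<close> is even; if \<open>dim V\<close> is odd there are
  two of them (\<open>c\<close> and \<open>-c\<close>), with the same operators \<open>spin A\<close>.\<close>

locale spinor_module = clifford_module +
  assumes dim_S: "S.dim UNIV = 2 ^ (vs.dim V div 2)"
    and simple_S: "S.subspace W \<Longrightarrow> (\<And>v s. v \<in> V \<Longrightarrow> s \<in> W \<Longrightarrow> c v s \<in> W) \<Longrightarrow> W = {0} \<or> W = UNIV"

section \<open>The Casimir element\<close>

text \<open>The action of \<open>\<Sum>\<^sub>j e'\<^sub>j e\<^sub>j\<close> (in the enveloping algebra) on a module with action \<open>\<pi>\<close>.\<close>

definition casimir_action :: "'i set \<Rightarrow> ('i \<Rightarrow> 'g) \<Rightarrow> ('i \<Rightarrow> 'g) \<Rightarrow> ('g \<Rightarrow> 's \<Rightarrow> 's) \<Rightarrow> 's \<Rightarrow> 's::ab_group_add" where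
  "casimir_action I e e' \<pi> s = (\<Sum>j\<in>I. \<pi> (e' j) (\<pi> (e j) s))"

end

theory Submission
  imports Defs
begin

text \<open>
  The Casimir operator is computed inside the Clifford algebra of \<open>\<gg>\<^sub>1\<close>, without roots or weights.
  Write \<open>\<Phi>\<close> for the Killing form, let \<open>v\<^sub>a\<close>, \<open>v\<^sup>a\<close> be dual bases of \<open>\<gg>\<^sub>1\<close> for \<open>\<Phi>\<close>, and write \<open>u w\<close> for
  the composite \<open>c u \<circ> c w\<close>, so that \<open>u w + w u = 2 \<Phi>(u, w)\<close>.

  An element \<open>A\<close> of \<open>so(\<gg>\<^sub>1)\<close> acts on spinors by \<open>1/4 \<Sum> A(v\<^sub>a) v\<^sup>a\<close> (lemma \<open>spin_eq\<close>). Hence the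
  Casimir operator is \<open>1/16\<close> times a sum of products of four Clifford generators. Since \<open>\<Phi>\<close> is
  invariant, the sum over the dual bases of \<open>\<gg>\<^sub>0\<close> can be carried out, which leaves
  \<open>1/16 \<Sum> [[v\<^sub>a, v\<^sub>b], v\<^sub>d] v\<^sup>d v\<^sup>b v\<^sup>a\<close> (lemma \<open>casimir_eq_quartic_sum\<close>). The triple bracket
  \<open>[[x, y], z]\<close> has the symmetries of the curvature tensor of the symmetric space attached to \<open>\<sigma>\<close>:
  it is skew in \<open>x, y\<close>, and the Jacobi identity is its first Bianchi identity. As in the Lichnerowicz
  formula for the square of the Dirac operator, these symmetries cancel everything but the
  contraction \<open>-1/8 \<Sum> [[v\<^sub>a, v\<^sub>b], v\<^sup>a] v\<^sup>b\<close> (lemma \<open>quartic_clifford_sum\<close>).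

  This contraction is a Ricci curvature. If \<open>x, y\<close> lie in \<open>\<gg>\<^sub>1\<close>, then \<open>ad x\<close> and \<open>ad y\<close> exchange \<open>\<gg>\<^sub>0\<close> and
  \<open>\<gg>\<^sub>1\<close>. The trace of \<open>ad x ad y\<close> on \<open>\<gg>\<^sub>0\<close> is thus that of \<open>ad y ad x\<close> on \<open>\<gg>\<^sub>1\<close>, which by invariance of
  \<open>\<Phi>\<close> is that of \<open>ad x ad y\<close> on \<open>\<gg>\<^sub>1\<close>; so \<open>\<Phi>(x, y)\<close> is twice the trace on \<open>\<gg>\<^sub>1\<close> alone. It follows that \<open>\<Sum>\<^sub>a [[v\<^sub>a, w], v\<^sup>a] = - w / 2\<close> (lemma
  \<open>ricci\<close>). The Casimir operator is therefore \<open>1/16 \<Sum> v\<^sub>b v\<^sup>b\<close>, and \<open>\<Sum> v\<^sub>b v\<^sup>b = dim \<gg>\<^sub>1\<close>.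

  Dual bases of \<open>\<gg>\<^sub>1\<close> exist because \<open>\<Phi>\<close> is nondegenerate. Its radical is an ideal, and it is not the
  whole algebra: with \<open>\<Phi> = 0\<close> the given dual bases of \<open>\<gg>\<^sub>0\<close> would have to be empty, so that
  \<open>\<gg> = \<gg>\<^sub>1\<close> and \<open>[\<gg>, \<gg>] \<subseteq> \<gg>\<^sub>0 = 0\<close>, whereas a simple algebra is not abelian.
\<close>

section \<open>Dual frames of a symmetric bilinear form\<close>

locale symmetric_form = vector_space scale
  for scale :: "'k::field \<Rightarrow> 'v::ab_group_add \<Rightarrow> 'v" (infixr "*s" 75) +
  fixes B :: "'v \<Rightarrow> 'v \<Rightarrow> 'k"
  assumes B_sym: "B x y = B y x"
    and B_add_left: "B (x + y) z = B x z + B y z"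
    and B_scale_left: "B (a *s x) y = a * B x y"
begin

lemma B_add_right: "B x (y + z) = B x y + B x z"
  by (metis B_add_left B_sym)

lemma B_scale_right: "B x (a *s y) = a * B x y"
  by (metis B_scale_left B_sym)

lemma B_zero_left [simp]: "B 0 y = 0"
  using B_scale_left[of 0 0 y] by simp

lemma B_zero_right [simp]: "B x 0 = 0"
  using B_zero_left B_sym by metis

lemma B_minus_left: "B (- x) y = - B x y"
  using B_scale_left[of "-1" x y] by simp

lemma B_minus_right: "B x (- y) = - B x y"
  using B_minus_left B_sym by metis

lemma B_sum_left: "B (sum f A) y = (\<Sum>i\<in>A. B (f i) y)"
  by (induction A rule: infinite_finite_induct) (auto simp: B_add_left)

text \<open>Dual bases of \<open>U\<close>, recorded through the two expansion formulas, which are the form in which they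
are used: a sum over a pair of dual bases is contracted by reading one of the formulas backwards.\<close>

definition dual_frames :: "'v set \<Rightarrow> 'i set \<Rightarrow> ('i \<Rightarrow> 'v) \<Rightarrow> ('i \<Rightarrow> 'v) \<Rightarrow> bool" where
  "dual_frames U I v v' \<longleftrightarrow> finite I \<and> v ` I \<subseteq> U \<and> v' ` I \<subseteq> U \<and>
     (\<forall>i\<in>I. \<forall>j\<in>I. B (v i) (v' j) = (if i = j then 1 else 0)) \<and>
     (\<forall>x\<in>U. x = (\<Sum>i\<in>I. B x (v' i) *s v i)) \<and> (\<forall>x\<in>U. x = (\<Sum>i\<in>I. B x (v i) *s v' i))"

lemma expansion_in_dual_family:
  assumes "finite I" "x \<in> span (b ` I)" "inj_on b I" "independent (b ` I)"
    and "\<And>i j. i \<in> I \<Longrightarrow> j \<in> I \<Longrightarrow> B (b i) (b' j) = (if i = j then 1 else 0)"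
  shows "x = (\<Sum>i\<in>I. B x (b' i) *s b i)"
proof -
  define a where "a i = representation (b ` I) x (b i)" for i
  have x: "x = (\<Sum>i\<in>I. a i *s b i)"
    using sum_representation_eq[OF assms(4,2) _ subset_refl] assms(1,3)
    by (simp add: sum.reindex a_def)
  have "B x (b' j) = a j" if "j \<in> I" for j
  proof -
    have "B x (b' j) = (\<Sum>i\<in>I. a i * B (b i) (b' j))"
      by (subst x) (simp add: B_sum_left B_scale_left)
    also have "\<dots> = (\<Sum>i\<in>I. if i = j then a i else 0)"
      by (rule sum.cong) (auto simp: assms(5) that)
    also have "\<dots> = a j"
      using that assms(1) by simp
    finally show ?thesis .
  qed
  then show ?thesis
    using x by simp
qed

text \<open>The map \<open>x \<mapsto> \<Sum> B(x, y) y\<close>, the sum running over the basis \<open>b\<close>, is injective by nondegeneracy, hence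
surjective by counting; the dual vector of \<open>y\<close> is its preimage of \<open>y\<close>.\<close>

lemma exists_dual_frames:
  assumes fin: "finite b" and ind: "independent b"
    and nondeg: "\<And>x. x \<in> span b \<Longrightarrow> (\<And>y. y \<in> span b \<Longrightarrow> B x y = 0) \<Longrightarrow> x = 0"
  shows "\<exists>b'. dual_frames (span b) b (\<lambda>y. y) b'"
proof -
  define T where "T x = (\<Sum>y\<in>b. B x y *s y)" for x
  interpret T: Vector_Spaces.linear scale scale T
    by (auto simp: Vector_Spaces.linear_iff T_def vector_space_axioms B_add_left B_scale_left scale_left_distrib
        sum.distrib scale_sum_right)
  have coeff: "B x y = f y" if "T x = (\<Sum>y\<in>b. f y *s y)" "y \<in> b" for x y f
  proof -
    have "(\<Sum>y\<in>b. (B x y - f y) *s y) = 0"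
      using that(1) by (simp add: T_def scale_left_diff_distrib sum_subtractf)
    then show ?thesis
      using independentD[OF ind fin subset_refl _ that(2), of "\<lambda>y. B x y - f y"] by simp
  qed
  have inj: "inj_on T (span b)"
    unfolding T.inj_on_iff_eq_0[OF subspace_span]
  proof (intro ballI impI)
    fix x assume x: "x \<in> span b" "T x = 0"
    have on_b: "B x y = 0" if "y \<in> b" for y
      using coeff[of x "\<lambda>_. 0" y] x(2) that by simp
    have "B x y = 0" if "y \<in> span b" for y
      using that by (induction rule: span_induct_alt) (simp_all add: B_add_right B_scale_right on_b)
    then show "x = 0"
      using nondeg x(1) by blast
  qed
  have indT: "independent (T ` b)"
    using T.independent_injective_image[OF ind inj] .
  have sub: "T ` b \<subseteq> span b"
    unfolding T_def by (intro image_subsetI span_sum span_scale span_base)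
  have card: "card (T ` b) = card b"
    by (rule card_image, rule inj_on_subset[OF inj span_superset])
  \<comment> \<open>A vector of \<open>b\<close> outside the span of \<open>T ` b\<close> would enlarge \<open>T ` b\<close> to an independent set
    with more elements than the spanning set \<open>b\<close>.\<close>
  have "y \<in> span (T ` b)" if "y \<in> b" for y
  proof (rule ccontr)
    assume y: "y \<notin> span (T ` b)"
    then have notin: "y \<notin> T ` b"
      using span_base by blast
    then have "independent (insert y (T ` b))"
      using indT y by (simp add: independent_insert)
    moreover have "insert y (T ` b) \<subseteq> span b"
      using sub that by (auto intro: span_base)
    ultimately have "card (insert y (T ` b)) \<le> card b"
      using independent_span_bound[OF fin] by blast
    then show False
      using card fin notin by simp
  qed
  then have "\<forall>y\<in>b. \<exists>x\<in>span b. T x = y"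
    by (auto simp: T.span_image image_iff)
  then obtain b' where b': "b' y \<in> span b" "T (b' y) = y" if "y \<in> b" for y
    by metis
  have delta: "B x (b' y) = (if x = y then 1 else 0)" if "x \<in> b" "y \<in> b" for x y
  proof -
    have "T (b' y) = (\<Sum>z\<in>b. (if z = y then 1 else 0) *s z)"
      using b' that(2) fin by (simp add: if_distrib[where f = "\<lambda>a. a *s _"] cong: if_cong)
    from coeff[OF this that(1)] show ?thesis
      by (simp add: B_sym)
  qed
  have "x = (\<Sum>y\<in>b. B x y *s b' y)" if "x \<in> span b" for x
  proof (rule inj_onD[OF inj _ that])
    show "T x = T (\<Sum>y\<in>b. B x y *s b' y)"
      by (simp add: T.sum T.scale b') (simp add: T_def)
    show "(\<Sum>y\<in>b. B x y *s b' y) \<in> span b"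
      by (intro span_sum span_scale b')
  qed
  moreover have "x = (\<Sum>y\<in>b. B x (b' y) *s y)" if "x \<in> span b" for x
    using expansion_in_dual_family[of b x "\<lambda>y. y" b'] fin ind that delta by simp
  ultimately show ?thesis
    unfolding dual_frames_def using fin b' delta by (intro exI[of _ b']) (auto intro: span_base)
qed

end

section \<open>The trace form of a Lie algebra\<close>

locale finite_dim_lie_algebra = lie_algebra +
  assumes finite_spanning_set: "\<exists>B. finite B \<and> span B = UNIV"
begin

lemma bracket_zero_left [simp]: "bracket 0 y = 0"
  using bracket_scale_left[of 0 0 y] by simp

lemma bracket_zero_right [simp]: "bracket x 0 = 0"
  using bracket_scale_right[of x 0 0] by simp

lemma bracket_minus_left: "bracket (- x) y = - bracket x y"
  using bracket_scale_left[of "-1" x y] by simp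

lemma bracket_minus_right: "bracket x (- y) = - bracket x y"
  using bracket_scale_right[of x "-1" y] by simp

lemma bracket_diff_right: "bracket x (y - z) = bracket x y - bracket x z"
  using bracket_add_right[of x y "- z"] by (simp add: bracket_minus_right)

lemma bracket_sum_left: "bracket (sum f A) y = (\<Sum>i\<in>A. bracket (f i) y)"
  by (induction A rule: infinite_finite_induct) (auto simp: bracket_add_left)

lemma bracket_sum_right: "bracket x (sum f A) = (\<Sum>i\<in>A. bracket x (f i))"
  by (induction A rule: infinite_finite_induct) (auto simp: bracket_add_right)

lemma bracket_antisym: "bracket x y = - bracket y x"
proof -
  have "0 = bracket (x + y) (x + y)"
    by (simp only: bracket_self)
  also have "\<dots> = bracket x y + bracket y x"
    by (simp only: bracket_add_left bracket_add_right) (simp add: bracket_self add.commute)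
  finally have "bracket x y + bracket y x = 0"
    by simp
  then show ?thesis
    by (simp add: eq_neg_iff_add_eq_0)
qed

lemma bracket_bracket: "bracket (bracket x y) z = bracket x (bracket y z) - bracket y (bracket x z)"
proof -
  have "bracket z (bracket x y) = - bracket (bracket x y) z"
    by (rule bracket_antisym)
  moreover have "bracket y (bracket z x) = - bracket y (bracket x z)"
    by (subst bracket_antisym[of z]) (simp add: bracket_minus_right)
  ultimately show ?thesis
    using jacobi[of x y z] by (simp add: algebra_simps)
qed

lemma linear_bracket: "Vector_Spaces.linear scale scale (bracket x)"
  by (simp add: Vector_Spaces.linear_iff vector_space_axioms bracket_add_right bracket_scale_right)

lemma linear_bracket_bracket: "Vector_Spaces.linear scale scale (\<lambda>z. bracket x (bracket y z))"
  by (simp add: Vector_Spaces.linear_iff vector_space_axioms bracket_add_right bracket_scale_right)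

lemma finite_extend_basis: "finite (extend_basis {})"
  using finite_spanning_set independent_span_bound independent_extend_basis[OF independent_empty]
  by blast

lemma extend_basis_expansion:
  "(\<Sum>b\<in>extend_basis {}. representation (extend_basis {}) z b *s b) = z"
  by (rule sum_representation_eq)
    (auto simp: independent_extend_basis independent_empty finite_extend_basis)

lemma representation_linear:
  "module_hom scale (*) (\<lambda>z. representation (extend_basis {}) z b)"
  using linear_representation[OF independent_extend_basis span_extend_basis]
  by (simp add: module_hom_iff_linear independent_empty)

lemma trace_add: "trace (\<lambda>z. S z + T z) = trace S + trace T"
  unfolding trace_def by (simp add: module_hom.add[OF representation_linear] sum.distrib)

lemma trace_diff: "trace (\<lambda>z. S z - T z) = trace S - trace T"
  unfolding trace_def by (simp add: module_hom.diff[OF representation_linear] sum_subtractf)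

lemma trace_scale: "trace (\<lambda>z. a *s T z) = a * trace T"
  unfolding trace_def by (simp add: module_hom.scale[OF representation_linear] sum_distrib_left)

text \<open>The trace is independent of the basis. The coordinate functionals \<open>\<phi> k\<close> can be prescribed freely, as
long as they reproduce every vector; this lets the trace be read off from bases of \<open>\<gg>\<^sub>0\<close> and \<open>\<gg>\<^sub>1\<close>
together.\<close>

lemma trace_eq_sum_frame:
  assumes fin: "finite K" and T: "Vector_Spaces.linear scale scale T"
    and \<phi>: "\<And>k. k \<in> K \<Longrightarrow> module_hom scale (*) (\<phi> k)"
    and expand: "\<And>z. z = (\<Sum>k\<in>K. \<phi> k z *s b k)"
  shows "trace T = (\<Sum>k\<in>K. \<phi> k (T (b k)))"
proof -
  let ?E = "extend_basis {}"
  let ?r = "representation (extend_basis {})"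
  interpret T: Vector_Spaces.linear scale scale T by fact
  have "(\<Sum>k\<in>K. \<phi> k (T (b k))) = (\<Sum>k\<in>K. \<phi> k (\<Sum>x\<in>?E. ?r (T (b k)) x *s x))"
    by (simp add: extend_basis_expansion)
  also have "\<dots> = (\<Sum>k\<in>K. \<Sum>x\<in>?E. ?r (T (b k)) x * \<phi> k x)"
    by (intro sum.cong) (simp_all add: module_hom.sum[OF \<phi>] module_hom.scale[OF \<phi>])
  also have "\<dots> = (\<Sum>x\<in>?E. \<Sum>k\<in>K. \<phi> k x * ?r (T (b k)) x)"
    by (subst sum.swap) (simp add: mult.commute)
  also have "\<dots> = (\<Sum>x\<in>?E. ?r (T (\<Sum>k\<in>K. \<phi> k x *s b k)) x)"
    by (simp add: T.sum T.scale module_hom.sum[OF representation_linear]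
        module_hom.scale[OF representation_linear])
  also have "\<dots> = trace T"
    by (simp add: trace_def expand[symmetric])
  finally show ?thesis by simp
qed

lemma trace_commute:
  assumes "Vector_Spaces.linear scale scale S" "Vector_Spaces.linear scale scale T"
  shows "trace (\<lambda>z. S (T z)) = trace (\<lambda>z. T (S z))"
proof -
  let ?E = "extend_basis {}"
  let ?r = "representation (extend_basis {})"
  have *: "trace (\<lambda>z. S (T z)) = (\<Sum>x\<in>?E. \<Sum>y\<in>?E. ?r (T x) y * ?r (S y) x)"
    if "Vector_Spaces.linear scale scale S" for S T
  proof -
    interpret S: Vector_Spaces.linear scale scale S by fact
    have "trace (\<lambda>z. S (T z)) = (\<Sum>x\<in>?E. ?r (S (\<Sum>y\<in>?E. ?r (T x) y *s y)) x)"
      by (simp add: extend_basis_expansion trace_def)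
    then show ?thesis
      by (simp add: S.sum S.scale module_hom.sum[OF representation_linear]
          module_hom.scale[OF representation_linear])
  qed
  have "trace (\<lambda>z. S (T z)) = (\<Sum>y\<in>?E. \<Sum>x\<in>?E. ?r (T x) y * ?r (S y) x)"
    unfolding *[OF assms(1)] by (rule sum.swap)
  then show ?thesis
    unfolding *[OF assms(2)] by (simp add: mult.commute)
qed

sublocale killing: symmetric_form scale killing
proof
  show "killing x y = killing y x" for x y
    unfolding killing_def by (rule trace_commute) (rule linear_bracket)+
  show "killing (x + y) z = killing x z + killing y z" for x y z
    unfolding killing_def bracket_add_left by (rule trace_add)
  show "killing (a *s x) y = a * killing x y" for a x y
    unfolding killing_def bracket_scale_left by (rule trace_scale)
qed

text \<open>After expanding the commutators on both sides, one pair of terms agrees literally and the other one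
agrees by a cyclic permutation under the trace.\<close>

lemma killing_invariant: "killing (bracket x y) z = killing x (bracket y z)"
proof -
  have eq: "trace (\<lambda>u. bracket y (bracket x (bracket z u))) = trace (\<lambda>u. bracket x (bracket z (bracket y u)))"
    using trace_commute[OF linear_bracket linear_bracket_bracket, of y x z] .
  show ?thesis
    unfolding killing_def bracket_bracket
    by (simp add: bracket_diff_right trace_diff eq)
qed

end

section \<open>Involutions and the Killing form\<close>

locale involutive_lie_algebra = finite_dim_lie_algebra scale bracket
  for scale :: "'k::field_char_0 \<Rightarrow> 'g::ab_group_add \<Rightarrow> 'g" (infixr "*s" 75)
    and bracket :: "'g \<Rightarrow> 'g \<Rightarrow> 'g" +
  fixes \<sigma> :: "'g \<Rightarrow> 'g"
  assumes involution: "involution \<sigma>"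
begin

sublocale \<sigma>: Vector_Spaces.linear scale scale \<sigma>
  using involution by (simp add: involution_def)

lemma \<sigma>_bracket: "\<sigma> (bracket x y) = bracket (\<sigma> x) (\<sigma> y)"
  using involution by (simp add: involution_def)

lemma \<sigma>_\<sigma> [simp]: "\<sigma> (\<sigma> x) = x"
  using involution by (simp add: involution_def fun_eq_iff)

lemma subspace_odd: "subspace (odd_part \<sigma>)"
  by (auto simp: subspace_def odd_part_def \<sigma>.add \<sigma>.scale)

lemma bracket_even_odd: "x \<in> even_part \<sigma> \<Longrightarrow> y \<in> odd_part \<sigma> \<Longrightarrow> bracket x y \<in> odd_part \<sigma>"
  by (simp add: even_part_def odd_part_def \<sigma>_bracket bracket_minus_right)

lemma bracket_odd_even: "x \<in> odd_part \<sigma> \<Longrightarrow> y \<in> even_part \<sigma> \<Longrightarrow> bracket x y \<in> odd_part \<sigma>"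
  by (simp add: even_part_def odd_part_def \<sigma>_bracket bracket_minus_left)

lemma bracket_odd_odd: "x \<in> odd_part \<sigma> \<Longrightarrow> y \<in> odd_part \<sigma> \<Longrightarrow> bracket x y \<in> even_part \<sigma>"
  by (simp add: even_part_def odd_part_def \<sigma>_bracket bracket_minus_left bracket_minus_right)

lemma even_odd_decomposition:
  obtains z0 z1 where "z0 \<in> even_part \<sigma>" "z1 \<in> odd_part \<sigma>" "z = z0 + z1"
proof
  show "(1/2) *s (z + \<sigma> z) \<in> even_part \<sigma>"
    by (simp add: even_part_def \<sigma>.add \<sigma>.scale add.commute)
  show "(1/2) *s (z - \<sigma> z) \<in> odd_part \<sigma>"
    by (simp add: odd_part_def \<sigma>.diff \<sigma>.scale scale_right_diff_distrib)
  have "(1/2) *s (z + \<sigma> z) + (1/2) *s (z - \<sigma> z) = (1/2) *s z + (1/2) *s z"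
    by (simp add: scale_right_distrib scale_right_diff_distrib)
  also have "\<dots> = (1/2 + 1/2) *s z"
    by (rule scale_left_distrib[symmetric])
  finally show "z = (1/2) *s (z + \<sigma> z) + (1/2) *s (z - \<sigma> z)"
    by simp
qed

lemma killing_\<sigma>: "killing (\<sigma> x) (\<sigma> y) = killing x y"
proof -
  have lin: "Vector_Spaces.linear scale scale (\<lambda>z. bracket x (bracket y (\<sigma> z)))"
    by (simp add: Vector_Spaces.linear_iff vector_space_axioms \<sigma>.add \<sigma>.scale bracket_add_right
        bracket_scale_right)
  have "killing (\<sigma> x) (\<sigma> y) = trace (\<lambda>z. \<sigma> (bracket x (bracket y (\<sigma> z))))"
    by (simp add: killing_def \<sigma>_bracket)
  also have "\<dots> = trace (\<lambda>z. bracket x (bracket y (\<sigma> (\<sigma> z))))"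
    by (rule trace_commute[OF \<sigma>.linear_axioms lin])
  finally show ?thesis
    by (simp add: killing_def)
qed

text \<open>An automorphism preserves the Killing form, so its eigenspaces for \<open>1\<close> and \<open>-1\<close> are orthogonal.\<close>

lemma killing_even_odd:
  assumes "x \<in> even_part \<sigma>" "y \<in> odd_part \<sigma>"
  shows "killing x y = 0"
proof -
  have "killing x y = - killing x y"
    using killing_\<sigma>[of x y] assms by (simp add: even_part_def odd_part_def killing.B_minus_right)
  then show ?thesis by simp
qed

lemma killing_radical_ideal: "lie_ideal {x. \<forall>y. killing x y = 0}"
  unfolding lie_ideal_def
proof (intro conjI allI ballI)
  show "subspace {x. \<forall>y. killing x y = 0}"
    by (simp add: subspace_def killing.B_add_left killing.B_scale_left)
  fix x y assume "y \<in> {x. \<forall>y. killing x y = 0}"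
  then have "killing (bracket y x) z = 0" for z
    by (simp add: killing_invariant)
  then show "bracket x y \<in> {x. \<forall>y. killing x y = 0}"
    by (subst bracket_antisym) (simp add: killing.B_minus_left)
qed

lemma killing_nondegenerate_odd:
  assumes nondeg: "\<And>x. (\<And>y. killing x y = 0) \<Longrightarrow> x = 0"
    and x: "x \<in> odd_part \<sigma>" "\<And>y. y \<in> odd_part \<sigma> \<Longrightarrow> killing x y = 0"
  shows "x = 0"
proof (rule nondeg)
  fix y
  obtain y0 y1 where y: "y0 \<in> even_part \<sigma>" "y1 \<in> odd_part \<sigma>" "y = y0 + y1"
    by (rule even_odd_decomposition)
  have "killing x y0 = 0"
    using killing_even_odd[OF y(1) x(1)] killing.B_sym by metis
  then show "killing x y = 0"
    using x(2) y by (simp add: killing.B_add_right)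
qed

end

text \<open>Nondegeneracy comes from the dual bases of \<open>\<gg>\<^sub>0\<close> rather than from Cartan's criterion: a zero Killing
form would force \<open>\<gg>\<^sub>0 = 0\<close>, and then \<open>[\<gg>\<^sub>1, \<gg>\<^sub>1] \<subseteq> \<gg>\<^sub>0\<close> makes the algebra abelian.\<close>

lemma killing_nondegenerate:
  assumes simple: "simple_lie_algebra scale bracket"
    and inv: "involutive_lie_algebra scale bracket \<sigma>"
    and dual: "lie_algebra.dual_bases scale (lie_algebra.killing scale bracket) (even_part \<sigma>) J e e'"
    and x: "\<And>y. lie_algebra.killing scale bracket x y = 0"
  shows "x = 0"
proof -
  interpret involutive_lie_algebra scale bracket \<sigma> by (rule inv)
  interpret S: simple_lie_algebra scale bracket by (rule simple)
  let ?R = "{x. \<forall>y. killing x y = 0}"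
  have "?R \<noteq> UNIV"
  proof
    assume "?R = UNIV"
    then have zero: "killing a b = 0" for a b
      by auto
    have "J = {}"
      using dual unfolding dual_bases_def zero by (metis equals0I zero_neq_one)
    then have "even_part \<sigma> = {0}"
      using dual by (simp add: dual_bases_def basis_family_def)
    then have "bracket a b = 0" for a b
    proof -
      have odd: "z \<in> odd_part \<sigma>" for z
        using even_odd_decomposition[of z] \<open>even_part \<sigma> = {0}\<close> by auto
      show ?thesis
        using bracket_odd_odd[OF odd odd] \<open>even_part \<sigma> = {0}\<close> by blast
    qed
    then show False
      using S.not_abelian by blast
  qed
  then have "?R = {0}"
    using S.ideals_trivial[OF killing_radical_ideal] by blast
  then show ?thesis
    using x by auto
qed

locale framed_involutive_lie_algebra = involutive_lie_algebra scale bracket \<sigma>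
  for scale :: "'k::field_char_0 \<Rightarrow> 'g::ab_group_add \<Rightarrow> 'g" (infixr "*s" 75)
    and bracket :: "'g \<Rightarrow> 'g \<Rightarrow> 'g" and \<sigma> :: "'g \<Rightarrow> 'g" +
  fixes J :: "'j set" and e e' :: "'j \<Rightarrow> 'g" and I :: "'i set" and v v' :: "'i \<Rightarrow> 'g"
  assumes even_frames: "killing.dual_frames (even_part \<sigma>) J e e'"
    and odd_frames: "killing.dual_frames (odd_part \<sigma>) I v v'"
begin

lemma finite_J: "finite J" and finite_I: "finite I"
  using even_frames odd_frames by (simp_all add: killing.dual_frames_def)

lemma e_even: "j \<in> J \<Longrightarrow> e j \<in> even_part \<sigma>" and e'_even: "j \<in> J \<Longrightarrow> e' j \<in> even_part \<sigma>"
  using even_frames by (auto simp: killing.dual_frames_def)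

lemma v_odd: "i \<in> I \<Longrightarrow> v i \<in> odd_part \<sigma>" and v'_odd: "i \<in> I \<Longrightarrow> v' i \<in> odd_part \<sigma>"
  using odd_frames by (auto simp: killing.dual_frames_def)

lemma even_expansion:
  assumes "x \<in> even_part \<sigma>"
  shows "(\<Sum>j\<in>J. killing x (e' j) *s e j) = x" "(\<Sum>j\<in>J. killing x (e j) *s e' j) = x"
  using even_frames assms by (simp_all add: killing.dual_frames_def)

lemma odd_expansion:
  assumes "x \<in> odd_part \<sigma>"
  shows "(\<Sum>i\<in>I. killing x (v' i) *s v i) = x" "(\<Sum>i\<in>I. killing x (v i) *s v' i) = x"
  using odd_frames assms by (simp_all add: killing.dual_frames_def)

lemma trace_eq_sum_even_odd:
  assumes T: "Vector_Spaces.linear scale scale T"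
  shows "trace T = (\<Sum>j\<in>J. killing (T (e j)) (e' j)) + (\<Sum>i\<in>I. killing (T (v i)) (v' i))"
proof -
  define \<phi> where "\<phi> k z = (case k of Inl j \<Rightarrow> killing z (e' j) | Inr i \<Rightarrow> killing z (v' i))" for k z
  define b where "b k = (case k of Inl j \<Rightarrow> e j | Inr i \<Rightarrow> v i)" for k
  have "trace T = (\<Sum>k\<in>J <+> I. \<phi> k (T (b k)))"
  proof (rule trace_eq_sum_frame[OF _ T])
    show "finite (J <+> I)"
      by (simp add: finite_I finite_J)
    show "module_hom scale (*) (\<phi> k)" for k
      by (auto simp: module_hom_iff module_axioms \<phi>_def killing.B_add_left killing.B_scale_left
          module_def algebra_simps split: sum.split)
    fix z
    obtain z0 z1 where z: "z0 \<in> even_part \<sigma>" "z1 \<in> odd_part \<sigma>" "z = z0 + z1"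
      by (rule even_odd_decomposition)
    have "killing z1 (e' j) = 0" if "j \<in> J" for j
      using killing_even_odd[OF e'_even[OF that] z(2)] killing.B_sym by metis
    moreover have "killing z0 (v' i) = 0" if "i \<in> I" for i
      using killing_even_odd[OF z(1) v'_odd[OF that]] .
    ultimately have "(\<Sum>k\<in>J <+> I. \<phi> k z *s b k)
        = (\<Sum>j\<in>J. killing z0 (e' j) *s e j) + (\<Sum>i\<in>I. killing z1 (v' i) *s v i)"
      by (simp add: sum.Plus finite_I finite_J \<phi>_def b_def z(3) killing.B_add_left cong: sum.cong)
    then show "z = (\<Sum>k\<in>J <+> I. \<phi> k z *s b k)"
      using even_expansion(1)[OF z(1)] odd_expansion(1)[OF z(2)] z(3) by simp
  qed
  then show ?thesis
    by (simp add: sum.Plus finite_I finite_J \<phi>_def b_def)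
qed

text \<open>The trace of \<open>ad x ad y\<close> splits into its parts on \<open>\<gg>\<^sub>0\<close> and \<open>\<gg>\<^sub>1\<close>. The two parts are equal, being the
traces of the two composites of \<open>ad y: \<gg>\<^sub>0 \<rightarrow> \<gg>\<^sub>1\<close> and \<open>ad x: \<gg>\<^sub>1 \<rightarrow> \<gg>\<^sub>0\<close> up to exchanging \<open>x\<close> and
\<open>y\<close>, which invariance of the form allows.\<close>

lemma killing_eq_twice_odd_trace:
  assumes x: "x \<in> odd_part \<sigma>" and y: "y \<in> odd_part \<sigma>"
  shows "killing x y = 2 * (\<Sum>i\<in>I. killing (bracket x (bracket y (v i))) (v' i))"
proof -
  have swap: "killing (bracket x (bracket y (e j))) (e' j)
      = (\<Sum>i\<in>I. killing (e j) (bracket y (v i)) * killing (bracket x (e' j)) (v' i))"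
    if j: "j \<in> J" for j
  proof -
    have "killing (bracket x (bracket y (e j))) (e' j) = - killing (bracket y (e j)) (bracket x (e' j))"
      by (subst bracket_antisym) (simp add: killing.B_minus_left killing_invariant)
    also have "\<dots> = - killing (\<Sum>i\<in>I. killing (bracket y (e j)) (v i) *s v' i) (bracket x (e' j))"
      using odd_expansion(2)[OF bracket_odd_even[OF y e_even[OF j]]] by simp
    also have "\<dots> = (\<Sum>i\<in>I. - killing (bracket y (e j)) (v i) * killing (bracket x (e' j)) (v' i))"
      by (simp add: killing.B_sum_left killing.B_scale_left sum_negf
          killing.B_sym[of "v' _" "bracket x (e' j)"])
    also have "\<dots> = (\<Sum>i\<in>I. killing (e j) (bracket y (v i)) * killing (bracket x (e' j)) (v' i))"
      by (subst bracket_antisym[of y "e j"]) (simp add: killing.B_minus_left killing_invariant)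
    finally show ?thesis .
  qed
  have "(\<Sum>j\<in>J. killing (bracket x (bracket y (e j))) (e' j))
      = (\<Sum>i\<in>I. \<Sum>j\<in>J. killing (e j) (bracket y (v i)) * killing (bracket x (e' j)) (v' i))"
    by (subst sum.swap) (simp add: swap)
  also have "\<dots> = (\<Sum>i\<in>I. killing (bracket x (\<Sum>j\<in>J. killing (bracket y (v i)) (e j) *s e' j)) (v' i))"
    by (simp add: killing.B_sum_left killing.B_scale_left bracket_sum_right bracket_scale_right
        killing.B_sym[of "e _"])
  also have "\<dots> = (\<Sum>i\<in>I. killing (bracket x (bracket y (v i))) (v' i))"
    by (rule sum.cong) (simp_all add: even_expansion bracket_odd_odd[OF y v_odd])
  finally show ?thesis
    unfolding killing_def[of x y] trace_eq_sum_even_odd[OF linear_bracket_bracket] by simp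
qed

text \<open>Pairing the left-hand side with \<open>y\<close> in \<open>\<gg>\<^sub>1\<close> gives, by invariance, minus the trace of \<open>ad y ad w\<close> on
\<open>\<gg>\<^sub>1\<close>, that is \<open>-1/2\<close> times the Killing form.\<close>

lemma ricci:
  assumes w: "w \<in> odd_part \<sigma>"
  shows "(\<Sum>i\<in>I. bracket (bracket (v i) w) (v' i)) = (-1/2) *s w" (is "?r = _")
proof -
  have r: "?r \<in> odd_part \<sigma>"
    by (intro subspace_sum[OF subspace_odd] bracket_even_odd bracket_odd_odd v_odd v'_odd w)
  have coeff: "killing ?r y = - killing w y / 2" if y: "y \<in> odd_part \<sigma>" for y
  proof -
    have "killing (bracket (bracket (v i) w) (v' i)) y = - killing (bracket y (bracket w (v i))) (v' i)" for i
    proof -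
      have "killing (bracket (bracket (v i) w) (v' i)) y = killing (bracket (v i) w) (bracket (v' i) y)"
        by (rule killing_invariant)
      also have "\<dots> = killing (bracket w (v i)) (bracket y (v' i))"
        by (subst bracket_antisym[of "v i"], subst bracket_antisym[of "v' i"])
          (simp add: killing.B_minus_left killing.B_minus_right)
      also have "\<dots> = killing (bracket (bracket w (v i)) y) (v' i)"
        by (simp add: killing_invariant)
      finally show ?thesis
        by (subst bracket_antisym[of y]) (simp add: killing.B_minus_left)
    qed
    then have "killing ?r y = - (\<Sum>i\<in>I. killing (bracket y (bracket w (v i))) (v' i))"
      by (simp add: killing.B_sum_left sum_negf)
    then show ?thesis
      using killing_eq_twice_odd_trace[OF y w] killing.B_sym[of y w] by simp
  qed
  have "?r = (\<Sum>i\<in>I. killing ?r (v i) *s v' i)"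
    using odd_expansion(2)[OF r] by simp
  also have "\<dots> = (-1/2) *s (\<Sum>i\<in>I. killing w (v i) *s v' i)"
    unfolding scale_sum_right by (rule sum.cong) (simp_all add: coeff v_odd)
  finally show ?thesis
    using odd_expansion(2)[OF w] by simp
qed

end

section \<open>Spin operators in a Clifford module\<close>

locale framed_clifford_module =
  clifford_module scale scaleS V B c + form: symmetric_form scale B
  for scale :: "'k::field_char_0 \<Rightarrow> 'v::ab_group_add \<Rightarrow> 'v" (infixr "*s" 75)
    and scaleS :: "'k \<Rightarrow> 's::ab_group_add \<Rightarrow> 's" (infixr "*S" 75)
    and V :: "'v set" and B :: "'v \<Rightarrow> 'v \<Rightarrow> 'k" and c :: "'v \<Rightarrow> 's \<Rightarrow> 's" +
  fixes I :: "'i set" and v v' :: "'i \<Rightarrow> 'v"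
  assumes frames: "form.dual_frames V I v v'"
begin

lemma v_in [simp]: "i \<in> I \<Longrightarrow> v i \<in> V" and v'_in [simp]: "i \<in> I \<Longrightarrow> v' i \<in> V"
  using frames by (auto simp: form.dual_frames_def)

lemma dual_v: "i \<in> I \<Longrightarrow> B (v i) (v' i) = 1"
  using frames by (auto simp: form.dual_frames_def)

lemma expansion:
  assumes "x \<in> V"
  shows "(\<Sum>i\<in>I. B x (v' i) *s v i) = x" "(\<Sum>i\<in>I. B x (v i) *s v' i) = x"
  using frames assms by (simp_all add: form.dual_frames_def)

lemma c_plus:
  assumes "u \<in> V"
  shows "c u (s + t) = c u s + c u t"
proof -
  interpret L: Vector_Spaces.linear scaleS scaleS "c u" by (rule linear_c[OF assms])
  show ?thesis by (rule L.add)
qed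

lemma c_mult:
  assumes "u \<in> V"
  shows "c u (a *S s) = a *S c u s"
proof -
  interpret L: Vector_Spaces.linear scaleS scaleS "c u" by (rule linear_c[OF assms])
  show ?thesis by (rule L.scale)
qed

lemma c_zero [simp]: "u \<in> V \<Longrightarrow> c u 0 = 0"
  using c_mult[of u 0 0] by simp

lemma c_minus: "u \<in> V \<Longrightarrow> c u (- s) = - c u s"
  using c_mult[of u "-1" s] by simp

lemma c_diff: "u \<in> V \<Longrightarrow> c u (s - t) = c u s - c u t"
  using c_plus[of u s "- t"] by (simp add: c_minus)

lemma c_sum: "u \<in> V \<Longrightarrow> c u (sum f A) = (\<Sum>i\<in>A. c u (f i))"
  by (induction A rule: infinite_finite_induct) (auto simp: c_plus)

lemma c_zero_left [simp]: "c 0 s = 0"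
  using c_scale[of 0 0 s] subspace_V by (simp add: vs.subspace_0)

lemma c_minus_left: "u \<in> V \<Longrightarrow> c (- u) s = - c u s"
  using c_scale[of u "-1" s] by simp

lemma c_sum_left:
  assumes "\<And>i. i \<in> A \<Longrightarrow> f i \<in> V"
  shows "c (sum f A) s = (\<Sum>i\<in>A. c (f i) s)"
  using assms
proof (induction A rule: infinite_finite_induct)
  case (insert x F)
  then show ?case
    using vs.subspace_sum[OF subspace_V, of F f] by (simp add: c_add)
qed auto

lemma c_sum_scale_left:
  assumes "\<And>i. i \<in> A \<Longrightarrow> f i \<in> V"
  shows "c (\<Sum>i\<in>A. a i *s f i) s = (\<Sum>i\<in>A. a i *S c (f i) s)"
  using assms by (simp add: c_sum_left c_scale vs.subspace_scale[OF subspace_V])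

lemma anticommute:
  assumes "x \<in> V" "y \<in> V"
  shows "c x (c y s) = (2 * B x y) *S s - c y (c x s)"
proof -
  have "c (x + y) (c (x + y) s) = B (x + y) (x + y) *S s"
    using assms vs.subspace_add[OF subspace_V] by (simp add: c_square)
  also have "\<dots> = B x x *S s + B y y *S s + (2 * B x y) *S s"
    by (simp add: form.B_add_left form.B_add_right form.B_sym[of y x] S.scale_left_distrib[symmetric])
  finally show ?thesis
    using assms by (simp add: c_add c_plus c_square algebra_simps)
qed

definition com :: "'v \<Rightarrow> 'v \<Rightarrow> 's \<Rightarrow> 's" where
  "com u w s = c u (c w s) - c w (c u s)"

text \<open>Up to the factor \<open>4\<close>, the commutator \<open>u w - w u\<close> acts on \<open>V\<close> as the elementary skew map
\<open>x \<mapsto> B(w, x) u - B(u, x) w\<close>.\<close>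

lemma com_commutator:
  assumes "u \<in> V" "w \<in> V" "x \<in> V"
  shows "com u w (c x s) - c x (com u w s) = (4 * B w x) *S c u s - (4 * B u x) *S c w s"
proof -
  have 1: "c x (c p (c q s)) = (2 * B p x) *S c q s - (2 * B q x) *S c p s + c p (c q (c x s))"
    if "p \<in> V" "q \<in> V" for p q
    using that assms(3)
    by (simp add: anticommute[of x p] anticommute[of x q] c_diff c_mult form.B_sym[of x])
  have 2: "(4 * a) *S t = (2 * a) *S t + (2 * a) *S t" for a t
    by (simp add: S.scale_left_distrib[symmetric])
  show ?thesis
    using assms by (simp add: com_def c_diff 1 2)
qed

lemma vector_space_fun: "vector_space (\<lambda>a T s. a *S T s)"
  by (simp add: vector_space_def fun_eq_iff S.scale_right_distrib S.scale_left_distrib)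

lemma spin_algebra_alt: "spin_algebra = module.span (\<lambda>a T s. a *S T s) {com u w | u w. u \<in> V \<and> w \<in> V}"
  by (simp add: spin_algebra_def com_def[abs_def])

text \<open>An element \<open>T\<close> of the spin algebra is determined by its commutators with \<open>V\<close>, through the formula
\<open>4 T = \<Sum> [T, v\<^sub>i] v\<^sup>i\<close>. Both sides are linear in \<open>T\<close>, so it suffices to check the generators
\<open>u w - w u\<close>, for which the sum contracts by the commutator formula above. This gives at once
the uniqueness and an explicit form of the operator that lifts a given skew map.\<close>

lemma spin_algebra_reconstruction:
  assumes "T \<in> spin_algebra"
  shows "4 *S T s = (\<Sum>i\<in>I. T (c (v i) (c (v' i) s)) - c (v i) (T (c (v' i) s)))"
proof -
  interpret F: vector_space "\<lambda>a (T :: 's \<Rightarrow> 's) s. a *S T s" by (rule vector_space_fun)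
  from assms[unfolded spin_algebra_alt] show ?thesis
  proof (induction rule: F.span_induct_alt)
    case base
    then show ?case by simp
  next
    case (step a T' T)
    then obtain u w where T': "T' = com u w" and uw: "u \<in> V" "w \<in> V"
      by auto
    have "(\<Sum>i\<in>I. com u w (c (v i) (c (v' i) s)) - c (v i) (com u w (c (v' i) s)))
        = (\<Sum>i\<in>I. (4 * B w (v i)) *S c u (c (v' i) s) - (4 * B u (v i)) *S c w (c (v' i) s))"
      by (rule sum.cong) (simp_all add: com_commutator uw)
    also have "\<dots> = 4 *S (c u (\<Sum>i\<in>I. B w (v i) *S c (v' i) s) - c w (\<Sum>i\<in>I. B u (v i) *S c (v' i) s))"
      by (simp add: c_sum c_mult uw sum_subtractf S.scale_sum_right S.scale_right_diff_distrib)
    also have "\<dots> = 4 *S com u w s"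
      using c_sum_scale_left[of I v' "\<lambda>i. B w (v i)" s] c_sum_scale_left[of I v' "\<lambda>i. B u (v i)" s] uw
      by (simp add: com_def expansion)
    finally have com: "(\<Sum>i\<in>I. com u w (c (v i) (c (v' i) s)) - c (v i) (com u w (c (v' i) s))) = 4 *S com u w s" .
    have "(\<Sum>i\<in>I. a *S com u w (c (v i) (c (v' i) s)) + T (c (v i) (c (v' i) s))
           - c (v i) (a *S com u w (c (v' i) s) + T (c (v' i) s)))
        = a *S (\<Sum>i\<in>I. com u w (c (v i) (c (v' i) s)) - c (v i) (com u w (c (v' i) s)))
          + (\<Sum>i\<in>I. T (c (v i) (c (v' i) s)) - c (v i) (T (c (v' i) s)))"
      unfolding S.scale_sum_right sum.distrib[symmetric]
      by (rule sum.cong) (simp_all add: c_plus c_mult S.scale_right_diff_distrib)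
    also have "\<dots> = a *S (4 *S com u w s) + 4 *S T s"
      by (simp add: com step.IH)
    finally show ?case
      by (simp add: T' S.scale_right_distrib S.scale_left_commute mult.commute)
  qed
qed

text \<open>Uniqueness and the formula come from the reconstruction lemma. For existence, the lift is taken to be
\<open>1/8 \<Sum> (A(v\<^sub>i) v\<^sup>i - v\<^sup>i A(v\<^sub>i))\<close>, which visibly lies in the spin algebra; the two halves of its
commutator with \<open>x\<close> both equal \<open>A(x)/2\<close>, the second one because \<open>A\<close> is skew.\<close>

lemma spin_eq:
  assumes A: "\<And>x. x \<in> V \<Longrightarrow> A x \<in> V"
    and add: "\<And>x y. A (x + y) = A x + A y" and scale: "\<And>a x. A (a *s x) = a *s A x"
    and skew: "\<And>x y. x \<in> V \<Longrightarrow> y \<in> V \<Longrightarrow> B (A x) y = - B x (A y)"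
  shows "spin A s = (1/4) *S (\<Sum>i\<in>I. c (A (v i)) (c (v' i) s))"
proof -
  interpret F: vector_space "\<lambda>a (T :: 's \<Rightarrow> 's) s. a *S T s" by (rule vector_space_fun)
  define R where "R s = (1/4) *S (\<Sum>i\<in>I. c (A (v i)) (c (v' i) s))" for s
  define P where "P T \<longleftrightarrow> T \<in> spin_algebra \<and> (\<forall>x\<in>V. \<forall>s. T (c x s) - c x (T s) = c (A x) s)" for T
  have unique: "T = R" if "P T" for T
  proof
    fix s
    have "4 *S T s = (\<Sum>i\<in>I. c (A (v i)) (c (v' i) s))"
      using that by (simp add: P_def spin_algebra_reconstruction)
    then have "(1/4) *S (4 *S T s) = R s"
      by (simp add: R_def)
    then show "T s = R s"
      by simp
  qed
  define T where "T = (\<Sum>i\<in>I. (\<lambda>s. (1/8) *S com (A (v i)) (v' i) s))"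
  have T: "T s = (1/8) *S (\<Sum>i\<in>I. com (A (v i)) (v' i) s)" for s
  proof -
    have "(\<Sum>i\<in>K. (\<lambda>s. (1/8) *S com (A (v i)) (v' i) s)) s = (1/8) *S (\<Sum>i\<in>K. com (A (v i)) (v' i) s)" for K
      by (induction K rule: infinite_finite_induct) (simp_all add: S.scale_right_distrib)
    then show ?thesis
      by (simp add: T_def)
  qed
  have "P T"
    unfolding P_def
  proof (intro conjI ballI allI)
    show "T \<in> spin_algebra"
      unfolding T_def spin_algebra_alt
      by (intro F.span_sum F.span_scale F.span_base) (use A v_in v'_in in blast)
    fix x s assume x: "x \<in> V"
    have A_sum: "A (sum f K) = (\<Sum>i\<in>K. A (f i))" for f and K :: "'i set"
    proof -
      have "A 0 = 0"
        using scale[of 0 0] by simp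
      then show ?thesis
        by (induction K rule: infinite_finite_induct) (simp_all add: add)
    qed
    have "T (c x s) - c x (T s)
        = (1/8) *S (\<Sum>i\<in>I. com (A (v i)) (v' i) (c x s) - c x (com (A (v i)) (v' i) s))"
      using x by (simp add: T c_mult c_sum sum_subtractf S.scale_right_diff_distrib)
    also have "\<dots> = (1/8) *S (\<Sum>i\<in>I. (4 * B (v' i) x) *S c (A (v i)) s - (4 * B (A (v i)) x) *S c (v' i) s)"
      using x A by (simp add: com_commutator)
    also have "\<dots> = (1/8) *S (\<Sum>i\<in>I. 4 *S (B x (v' i) *S c (A (v i)) s) + 4 *S (B (A x) (v i) *S c (v' i) s))"
      using x A by (simp add: skew form.B_sym[of "A x"] form.B_sym[of x])
    also have "\<dots> = (1/8) *S (4 *S ((\<Sum>i\<in>I. B x (v' i) *S c (A (v i)) s) + (\<Sum>i\<in>I. B (A x) (v i) *S c (v' i) s)))"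
      by (simp add: sum.distrib S.scale_sum_right S.scale_right_distrib)
    also have "(\<Sum>i\<in>I. B x (v' i) *S c (A (v i)) s) = c (A (\<Sum>i\<in>I. B x (v' i) *s v i)) s"
      by (simp add: A_sum scale c_sum_scale_left A)
    also have "\<dots> = c (A x) s"
      by (simp add: expansion x)
    also have "(\<Sum>i\<in>I. B (A x) (v i) *S c (v' i) s) = c (\<Sum>i\<in>I. B (A x) (v i) *s v' i) s"
      by (simp add: c_sum_scale_left)
    also have "\<dots> = c (A x) s"
      by (simp add: expansion x A)
    also have "(1/8) *S (4 *S (c (A x) s + c (A x) s)) = c (A x) s"
    proof -
      have "(1/8) *S (4 *S (c (A x) s + c (A x) s)) = (1/2 + 1/2) *S c (A x) s"
        unfolding S.scale_left_distrib by (simp add: S.scale_right_distrib)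
      then show ?thesis by simp
    qed
    finally show "T (c x s) - c x (T s) = c (A x) s" .
  qed
  have "spin A = (THE T. P T)"
    by (simp add: spin_def P_def)
  also have "\<dots> = R"
    using unique \<open>P T\<close> by (metis the_equality)
  finally show ?thesis
    by (simp add: R_def)
qed

text \<open>The tensor \<open>\<Sum> v\<^sub>i \<otimes> v\<^sup>i\<close> is symmetric, so the sum is half of \<open>\<Sum> (v\<^sub>i v\<^sup>i + v\<^sup>i v\<^sub>i) = \<Sum> 2 B(v\<^sub>i, v\<^sup>i)\<close>.\<close>

lemma sum_dual_clifford_products: "(\<Sum>i\<in>I. c (v i) (c (v' i) s)) = of_nat (card I) *S s"
proof -
  have "(\<Sum>i\<in>I. c (v i) (c (v' i) s)) = (\<Sum>i\<in>I. \<Sum>j\<in>I. B (v i) (v j) *S c (v' j) (c (v' i) s))"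
  proof (rule sum.cong[OF refl])
    fix i assume "i \<in> I"
    then show "c (v i) (c (v' i) s) = (\<Sum>j\<in>I. B (v i) (v j) *S c (v' j) (c (v' i) s))"
      using c_sum_scale_left[of I v' "\<lambda>j. B (v i) (v j)" "c (v' i) s"] by (simp add: expansion)
  qed
  also have "\<dots> = (\<Sum>j\<in>I. \<Sum>i\<in>I. B (v j) (v i) *S c (v' j) (c (v' i) s))"
    by (subst sum.swap) (simp add: form.B_sym)
  also have "\<dots> = (\<Sum>j\<in>I. c (v' j) (c (v j) s))"
  proof (rule sum.cong[OF refl])
    fix j assume "j \<in> I"
    then show "(\<Sum>i\<in>I. B (v j) (v i) *S c (v' j) (c (v' i) s)) = c (v' j) (c (v j) s)"
      using c_sum_scale_left[of I v' "\<lambda>i. B (v j) (v i)" s, symmetric]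
      by (simp add: expansion c_sum[symmetric] c_mult[symmetric])
  qed
  finally have swap: "(\<Sum>i\<in>I. c (v i) (c (v' i) s)) = (\<Sum>i\<in>I. c (v' i) (c (v i) s))" .
  have "(\<Sum>i\<in>I. c (v i) (c (v' i) s)) + (\<Sum>i\<in>I. c (v' i) (c (v i) s)) = (\<Sum>i\<in>I. 2 *S s)"
    unfolding sum.distrib[symmetric]
    by (rule sum.cong) (simp_all add: anticommute[of "v _" "v' _"] dual_v)
  also have "\<dots> = 2 *S (of_nat (card I) *S s)"
    by (simp add: S.sum_constant_scale mult.commute)
  finally have "2 *S (\<Sum>i\<in>I. c (v i) (c (v' i) s)) = 2 *S (of_nat (card I) *S s)"
    unfolding swap by (metis S.scale_left_distrib S.scale_one one_add_one)
  then show ?thesis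
    by (metis S.scale_cancel_left zero_neq_numeral)
qed

lemma sum_cyclic:
  "(\<Sum>a\<in>I. \<Sum>b\<in>I. \<Sum>d\<in>I. f b d a) = (\<Sum>a\<in>I. \<Sum>b\<in>I. \<Sum>d\<in>I. f a b (d::'i) :: 's)"
proof -
  have "(\<Sum>a\<in>I. \<Sum>b\<in>I. \<Sum>d\<in>I. f b d a) = (\<Sum>b\<in>I. \<Sum>a\<in>I. \<Sum>d\<in>I. f b d a)"
    by (rule sum.swap)
  also have "\<dots> = (\<Sum>b\<in>I. \<Sum>d\<in>I. \<Sum>a\<in>I. f b d a)"
    by (rule sum.cong[OF refl], rule sum.swap)
  finally show ?thesis .
qed

text \<open>The algebraic core of the Lichnerowicz formula. Let \<open>Q\<close> be the sum on the left. The Bianchi identity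
and a renaming of the indices turn \<open>Q\<close> into minus the sum of \<open>t(v\<^sub>a, v\<^sub>b, v\<^sub>d)\<close> times the words
\<open>v\<^sup>b v\<^sup>a v\<^sup>d\<close> and \<open>v\<^sup>a v\<^sup>d v\<^sup>b\<close>. Both are even permutations of \<open>v\<^sup>d v\<^sup>b v\<^sup>a\<close>, so sorting them yields
\<open>Q = -2 Q + contractions\<close>. The contraction of the skew pair \<open>a, b\<close> vanishes and the other two are
opposite to each other, which leaves \<open>3 Q = -6 X\<close> with \<open>X\<close> the double sum on the right.\<close>

lemma quartic_clifford_sum:
  assumes closed: "\<And>x y z. x \<in> V \<Longrightarrow> y \<in> V \<Longrightarrow> z \<in> V \<Longrightarrow> t x y z \<in> V"
    and add: "\<And>x y z w. t x y (z + w) = t x y z + t x y w"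
    and scale: "\<And>x y a z. t x y (a *s z) = a *s t x y z"
    and skew: "\<And>x y z. t x y z = - t y x z"
    and bianchi: "\<And>x y z. t x y z + t y z x + t z x y = 0"
  shows "(\<Sum>a\<in>I. \<Sum>b\<in>I. \<Sum>d\<in>I. c (t (v a) (v b) (v d)) (c (v' d) (c (v' b) (c (v' a) s))))
       = (-2) *S (\<Sum>a\<in>I. \<Sum>b\<in>I. c (t (v a) (v b) (v' a)) (c (v' b) s))"
proof -
  \<comment> \<open>\<open>X\<close>, \<open>Y\<close> and \<open>Z\<close> are the contractions of the pairs \<open>a, d\<close>, of \<open>b, d\<close> and of \<open>a, b\<close>; a word
    \<open>W\<close> lists its three upper indices from left to right.\<close>
  define \<tau> where "\<tau> a b d = c (t (v a) (v b) (v d))" for a b d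
  define g where "g a b = B (v' a) (v' b)" for a b
  define W where "W x y z = c (v' x) (c (v' y) (c (v' z) s))" for x y z
  define Q where "Q = (\<Sum>a\<in>I. \<Sum>b\<in>I. \<Sum>d\<in>I. \<tau> a b d (W d b a))"
  define X where "X = (\<Sum>a\<in>I. \<Sum>b\<in>I. \<Sum>d\<in>I. g a d *S \<tau> a b d (c (v' b) s))"
  define Y where "Y = (\<Sum>a\<in>I. \<Sum>b\<in>I. \<Sum>d\<in>I. g b d *S \<tau> a b d (c (v' a) s))"
  define Z where "Z = (\<Sum>a\<in>I. \<Sum>b\<in>I. \<Sum>d\<in>I. g a b *S \<tau> a b d (c (v' d) s))"
  have in_V: "t (v a) (v b) (v d) \<in> V" if "a \<in> I" "b \<in> I" "d \<in> I" for a b d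
    using closed that by simp
  have \<tau>_skew: "\<tau> a b d r = - \<tau> b a d r" if "a \<in> I" "b \<in> I" "d \<in> I" for a b d r
    unfolding \<tau>_def using in_V[of b a d] that by (subst skew) (simp add: c_minus_left)
  have \<tau>_bianchi: "\<tau> a b d r = - \<tau> b d a r - \<tau> d a b r" if "a \<in> I" "b \<in> I" "d \<in> I" for a b d r
  proof -
    have "c (t (v a) (v b) (v d) + t (v b) (v d) (v a) + t (v d) (v a) (v b)) r
        = \<tau> a b d r + \<tau> b d a r + \<tau> d a b r"
      using that by (simp add: \<tau>_def c_add in_V vs.subspace_add[OF subspace_V])
    then have "0 = \<tau> a b d r + \<tau> b d a r + \<tau> d a b r"
      by (simp only: bianchi c_zero_left)
    then show ?thesis
      by (simp add: algebra_simps eq_neg_iff_add_eq_0)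
  qed
  have swap_ab: "(\<Sum>a\<in>I. \<Sum>b\<in>I. \<Sum>d\<in>I. f a b d) = (\<Sum>a\<in>I. \<Sum>b\<in>I. \<Sum>d\<in>I. f b a d)" for f :: "'i \<Rightarrow> 'i \<Rightarrow> 'i \<Rightarrow> 's"
    by (rule sum.swap)
  have "Y = (\<Sum>a\<in>I. \<Sum>b\<in>I. \<Sum>d\<in>I. g a d *S \<tau> b a d (c (v' b) s))"
    unfolding Y_def by (rule swap_ab)
  also have "\<dots> = - X"
    unfolding X_def sum_negf[symmetric]
  proof (intro sum.cong refl)
    fix a b d assume "a \<in> I" "b \<in> I" "d \<in> I"
    then show "g a d *S \<tau> b a d (c (v' b) s) = - (g a d *S \<tau> a b d (c (v' b) s))"
      using \<tau>_skew[of b a d "c (v' b) s"] by simp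
  qed
  finally have Y: "Y = - X" .
  have "Z = (\<Sum>a\<in>I. \<Sum>b\<in>I. \<Sum>d\<in>I. g b a *S \<tau> b a d (c (v' d) s))"
    unfolding Z_def by (rule swap_ab)
  also have "\<dots> = - Z"
    unfolding Z_def sum_negf[symmetric]
  proof (intro sum.cong refl)
    fix a b d assume "a \<in> I" "b \<in> I" "d \<in> I"
    then show "g b a *S \<tau> b a d (c (v' d) s) = - (g a b *S \<tau> a b d (c (v' d) s))"
      using \<tau>_skew[of b a d "c (v' d) s"] by (simp add: g_def form.B_sym[of "v' b"])
  qed
  finally have "2 *S Z = 0"
    by (metis S.scale_left_distrib S.scale_one one_add_one add.right_inverse)
  then have Z: "Z = 0"
    by simp
  have words: "\<tau> a b d (W b a d) + \<tau> a b d (W a d b)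
      = 2 *S \<tau> a b d (W d b a) + 4 *S (g a d *S \<tau> a b d (c (v' b) s))
        - 2 *S (g b d *S \<tau> a b d (c (v' a) s)) - 2 *S (g a b *S \<tau> a b d (c (v' d) s))"
    if "a \<in> I" "b \<in> I" "d \<in> I" for a b d
  proof -
    have bad: "W b a d = (2 * g a d) *S c (v' b) s - (2 * g b d) *S c (v' a) s + W d b a"
      using that by (simp add: W_def g_def anticommute[of "v' a" "v' d"] anticommute[of "v' b" "v' d"] c_diff c_mult)
    have adb: "W a d b = (2 * g a d) *S c (v' b) s - (2 * g a b) *S c (v' d) s + W d b a"
      using that by (simp add: W_def g_def anticommute[of "v' a" "v' d"] anticommute[of "v' a" "v' b"] c_diff c_mult)
    have 2: "2 *S r = r + r" and 4: "4 *S r = 2 *S r + 2 *S r" for r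
      using S.scale_left_distrib[of 1 1 r] S.scale_left_distrib[of 2 2 r] by simp_all
    show ?thesis
      using in_V[OF that] unfolding bad adb 4 unfolding 2[of "\<tau> a b d (W d b a)"]
      by (simp add: \<tau>_def c_plus c_diff c_mult)
  qed
  have "Q = (\<Sum>a\<in>I. \<Sum>b\<in>I. \<Sum>d\<in>I. - \<tau> b d a (W d b a) - \<tau> d a b (W d b a))"
    unfolding Q_def by (intro sum.cong refl \<tau>_bianchi)
  also have "\<dots> = - ((\<Sum>a\<in>I. \<Sum>b\<in>I. \<Sum>d\<in>I. \<tau> b d a (W d b a)) + (\<Sum>a\<in>I. \<Sum>b\<in>I. \<Sum>d\<in>I. \<tau> d a b (W d b a)))"
    by (simp add: sum.distrib sum_negf sum_subtractf)
  also have "(\<Sum>a\<in>I. \<Sum>b\<in>I. \<Sum>d\<in>I. \<tau> b d a (W d b a)) = (\<Sum>a\<in>I. \<Sum>b\<in>I. \<Sum>d\<in>I. \<tau> a b d (W b a d))"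
    by (rule sum_cyclic[of "\<lambda>a b d. \<tau> a b d (W b a d)"])
  also have "(\<Sum>a\<in>I. \<Sum>b\<in>I. \<Sum>d\<in>I. \<tau> d a b (W d b a)) = (\<Sum>a\<in>I. \<Sum>b\<in>I. \<Sum>d\<in>I. \<tau> a b d (W a d b))"
    by (rule sum_cyclic[of "\<lambda>a b d. \<tau> d a b (W d b a)", symmetric])
  finally have "Q = - (\<Sum>a\<in>I. \<Sum>b\<in>I. \<Sum>d\<in>I. \<tau> a b d (W b a d) + \<tau> a b d (W a d b))"
    by (simp add: sum.distrib)
  also have "\<dots> = - (\<Sum>a\<in>I. \<Sum>b\<in>I. \<Sum>d\<in>I. 2 *S \<tau> a b d (W d b a) + 4 *S (g a d *S \<tau> a b d (c (v' b) s))
        - 2 *S (g b d *S \<tau> a b d (c (v' a) s)) - 2 *S (g a b *S \<tau> a b d (c (v' d) s)))"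
    by (simp add: words)
  also have "\<dots> = - (2 *S Q + 4 *S X - 2 *S Y - 2 *S Z)"
    by (simp only: Q_def X_def Y_def Z_def S.scale_sum_right sum.distrib sum_subtractf)
  also have "\<dots> = - (2 *S Q) - (4 *S X + 2 *S X)"
    by (simp add: Y Z)
  also have "4 *S X + 2 *S X = 6 *S X"
    by (simp add: S.scale_left_distrib[symmetric])
  finally have "Q = - (2 *S Q) - 6 *S X" .
  from arg_cong[of Q _ "\<lambda>r. r + 2 *S Q", OF this] have "Q + 2 *S Q = - (6 *S X)"
    by simp
  moreover have "Q + 2 *S Q = 3 *S Q"
    using S.scale_left_distrib[of 1 2 Q] by simp
  ultimately have "3 *S Q = 3 *S ((-2) *S X)"
    by simp
  then have "Q = (-2) *S X"
    by (metis S.scale_cancel_left zero_neq_numeral)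
  moreover have "X = (\<Sum>a\<in>I. \<Sum>b\<in>I. c (t (v a) (v b) (v' a)) (c (v' b) s))"
    unfolding X_def
  proof (intro sum.cong refl)
    fix a b assume ab: "a \<in> I" "b \<in> I"
    have t_sum: "t x y (sum f K) = (\<Sum>i\<in>K. t x y (f i))" for x y f and K :: "'i set"
    proof -
      have "t x y 0 = 0"
        using scale[of x y 0 0] by simp
      then show ?thesis
        by (induction K rule: infinite_finite_induct) (simp_all add: add)
    qed
    have "(\<Sum>d\<in>I. g a d *S \<tau> a b d (c (v' b) s)) = c (t (v a) (v b) (\<Sum>d\<in>I. g a d *s v d)) (c (v' b) s)"
      by (simp add: t_sum scale c_sum_scale_left in_V ab \<tau>_def)
    then show "(\<Sum>d\<in>I. g a d *S \<tau> a b d (c (v' b) s)) = c (t (v a) (v b) (v' a)) (c (v' b) s)"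
      by (simp add: g_def expansion ab)
  qed
  ultimately show ?thesis
    by (simp add: Q_def \<tau>_def W_def)
qed

end

section \<open>The Casimir element on the spinor module\<close>

locale framed_spin_symmetric_pair =
  framed_involutive_lie_algebra scale bracket \<sigma> J e e' I v v' +
  cl: framed_clifford_module scale scaleS "odd_part \<sigma>" "lie_algebra.killing scale bracket" c I v v'
  for scale :: "'k::field_char_0 \<Rightarrow> 'g::ab_group_add \<Rightarrow> 'g" (infixr "*s" 75)
    and bracket :: "'g \<Rightarrow> 'g \<Rightarrow> 'g" and \<sigma> :: "'g \<Rightarrow> 'g"
    and J :: "'j set" and e e' :: "'j \<Rightarrow> 'g" and I :: "'i set" and v v' :: "'i \<Rightarrow> 'g"
    and scaleS :: "'k \<Rightarrow> 's::ab_group_add \<Rightarrow> 's" (infixr "*S" 75)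
    and c :: "'g \<Rightarrow> 's \<Rightarrow> 's"
begin

lemma spin_bracket:
  assumes x: "x \<in> even_part \<sigma>"
  shows "cl.spin (bracket x) s = (1/4) *S (\<Sum>i\<in>I. c (bracket x (v i)) (c (v' i) s))"
proof (rule cl.spin_eq)
  show "killing (bracket x a) b = - killing a (bracket x b)" for a b
    by (subst bracket_antisym) (simp add: killing.B_minus_left killing_invariant)
qed (simp_all add: bracket_even_odd x bracket_add_right bracket_scale_right)

text \<open>Recombines \<open>\<Sum> \<Phi>(x, e\<^sub>j) e'\<^sub>j = x\<close> inside a Clifford generator; this removes the dual bases of \<open>\<gg>\<^sub>0\<close> from
the Casimir operator.\<close>

lemma sum_even_contraction:
  assumes x: "x \<in> even_part \<sigma>" and w: "w \<in> odd_part \<sigma>"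
  shows "(\<Sum>j\<in>J. killing x (e j) *S c (bracket (e' j) w) r) = c (bracket x w) r"
proof -
  have "(\<Sum>j\<in>J. killing x (e j) *S c (bracket (e' j) w) r) = c (bracket (\<Sum>j\<in>J. killing x (e j) *s e' j) w) r"
    by (simp add: bracket_sum_left bracket_scale_left cl.c_sum_scale_left bracket_even_odd e'_even w)
  then show ?thesis
    by (simp add: even_expansion x)
qed

text \<open>The factor \<open>[e\<^sub>j, v\<^sub>a]\<close> is expanded in the basis \<open>v\<^sup>b\<close>. Its coefficients \<open>\<Phi>([e\<^sub>j, v\<^sub>a], v\<^sub>b)\<close> are equal to
\<open>\<Phi>([v\<^sub>a, v\<^sub>b], e\<^sub>j)\<close>, and with them the sum over \<open>j\<close> turns \<open>[e'\<^sub>j, v\<^sub>d]\<close> into \<open>[[v\<^sub>a, v\<^sub>b], v\<^sub>d]\<close>.\<close>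

lemma casimir_eq_quartic_sum:
  "(\<Sum>j\<in>J. cl.spin (bracket (e' j)) (cl.spin (bracket (e j)) s))
     = (1/16) *S (\<Sum>a\<in>I. \<Sum>b\<in>I. \<Sum>d\<in>I. c (bracket (bracket (v a) (v b)) (v d)) (c (v' d) (c (v' b) (c (v' a) s))))"
proof -
  define f where "f j d a b = killing (bracket (v a) (v b)) (e j) *S
      c (bracket (e' j) (v d)) (c (v' d) (c (v' b) (c (v' a) s)))" for j d a b
  have contract: "c (bracket (e' j) (v d)) (c (v' d) (c (bracket (e j) (v a)) (c (v' a) s))) = (\<Sum>b\<in>I. f j d a b)"
    if "j \<in> J" "d \<in> I" "a \<in> I" for j d a
  proof -
    have "c (bracket (e j) (v a)) (c (v' a) s)
        = c (\<Sum>b\<in>I. killing (bracket (e j) (v a)) (v b) *s v' b) (c (v' a) s)"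
      using that by (simp add: odd_expansion bracket_even_odd e_even v_odd)
    also have "\<dots> = (\<Sum>b\<in>I. killing (bracket (v a) (v b)) (e j) *S c (v' b) (c (v' a) s))"
      by (simp add: cl.c_sum_scale_left killing_invariant killing.B_sym[of "e j"])
    finally show ?thesis
      using that by (simp add: f_def cl.c_sum cl.c_mult bracket_even_odd e'_even v_odd)
  qed
  have "(\<Sum>j\<in>J. cl.spin (bracket (e' j)) (cl.spin (bracket (e j)) s))
      = (\<Sum>j\<in>J. (1/16) *S (\<Sum>d\<in>I. \<Sum>a\<in>I. \<Sum>b\<in>I. f j d a b))"
  proof (rule sum.cong[OF refl])
    fix j assume j: "j \<in> J"
    have "cl.spin (bracket (e' j)) (cl.spin (bracket (e j)) s)
        = (1/4) *S ((1/4) *S (\<Sum>d\<in>I. \<Sum>a\<in>I. c (bracket (e' j) (v d)) (c (v' d) (c (bracket (e j) (v a)) (c (v' a) s)))))"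
      using j by (simp add: spin_bracket e_even e'_even cl.c_sum cl.c_mult bracket_even_odd v_odd cl.S.scale_sum_right)
    then show "cl.spin (bracket (e' j)) (cl.spin (bracket (e j)) s) = (1/16) *S (\<Sum>d\<in>I. \<Sum>a\<in>I. \<Sum>b\<in>I. f j d a b)"
      using j by (simp add: contract)
  qed
  also have "\<dots> = (1/16) *S (\<Sum>j\<in>J. \<Sum>d\<in>I. \<Sum>a\<in>I. \<Sum>b\<in>I. f j d a b)"
    by (simp add: cl.S.scale_sum_right)
  also have "(\<Sum>j\<in>J. \<Sum>d\<in>I. \<Sum>a\<in>I. \<Sum>b\<in>I. f j d a b) = (\<Sum>d\<in>I. \<Sum>j\<in>J. \<Sum>a\<in>I. \<Sum>b\<in>I. f j d a b)"
    by (rule sum.swap)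
  also have "\<dots> = (\<Sum>d\<in>I. \<Sum>a\<in>I. \<Sum>j\<in>J. \<Sum>b\<in>I. f j d a b)"
    by (rule sum.cong[OF refl], rule sum.swap)
  also have "\<dots> = (\<Sum>d\<in>I. \<Sum>a\<in>I. \<Sum>b\<in>I. \<Sum>j\<in>J. f j d a b)"
    by (rule sum.cong[OF refl], rule sum.cong[OF refl], rule sum.swap)
  also have "\<dots> = (\<Sum>a\<in>I. \<Sum>b\<in>I. \<Sum>d\<in>I. \<Sum>j\<in>J. f j d a b)"
    by (rule cl.sum_cyclic)
  also have "\<dots> = (\<Sum>a\<in>I. \<Sum>b\<in>I. \<Sum>d\<in>I. c (bracket (bracket (v a) (v b)) (v d)) (c (v' d) (c (v' b) (c (v' a) s))))"
    unfolding f_def by (intro sum.cong refl) (simp add: sum_even_contraction bracket_odd_odd v_odd)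
  finally show ?thesis .
qed

lemma casimir_spin:
  "(\<Sum>j\<in>J. cl.spin (bracket (e' j)) (cl.spin (bracket (e j)) s)) = (of_nat (card I) / 16) *S s"
proof -
  have "(\<Sum>a\<in>I. \<Sum>b\<in>I. c (bracket (bracket (v a) (v b)) (v' a)) (c (v' b) s))
      = (\<Sum>b\<in>I. c (\<Sum>a\<in>I. bracket (bracket (v a) (v b)) (v' a)) (c (v' b) s))"
    by (subst sum.swap) (simp add: cl.c_sum_left bracket_even_odd bracket_odd_odd v_odd v'_odd)
  also have "\<dots> = (\<Sum>b\<in>I. (-1/2) *S c (v b) (c (v' b) s))"
    by (rule sum.cong[OF refl]) (subst ricci, auto simp only: v_odd cl.c_scale)
  also have "\<dots> = (-1/2) *S (of_nat (card I) *S s)"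
    by (simp only: cl.S.scale_sum_right[symmetric] cl.sum_dual_clifford_products)
  finally have X: "(\<Sum>a\<in>I. \<Sum>b\<in>I. c (bracket (bracket (v a) (v b)) (v' a)) (c (v' b) s))
      = (-1/2) *S (of_nat (card I) *S s)" .
  have bianchi: "bracket (bracket x y) z + bracket (bracket y z) x + bracket (bracket z x) y = 0" for x y z
  proof -
    have "- (bracket (bracket x y) z + bracket (bracket y z) x + bracket (bracket z x) y) = 0"
      using jacobi[of z x y]
      unfolding bracket_antisym[of z "bracket x y"] bracket_antisym[of x "bracket y z"]
        bracket_antisym[of y "bracket z x"]
      by simp
    then show ?thesis
      by (simp only: neg_equal_0_iff_equal)
  qed
  have skew: "bracket (bracket x y) z = - bracket (bracket y x) z" for x y z
    by (subst bracket_antisym[of x y]) (rule bracket_minus_left)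
  have "(\<Sum>a\<in>I. \<Sum>b\<in>I. \<Sum>d\<in>I. c (bracket (bracket (v a) (v b)) (v d)) (c (v' d) (c (v' b) (c (v' a) s))))
      = (-2) *S (\<Sum>a\<in>I. \<Sum>b\<in>I. c (bracket (bracket (v a) (v b)) (v' a)) (c (v' b) s))"
    by (rule cl.quartic_clifford_sum[where t = "\<lambda>x y z. bracket (bracket x y) z"])
      (simp_all add: bracket_even_odd bracket_odd_odd bracket_add_right bracket_scale_right bianchi,
        rule skew)
  then show ?thesis
    by (simp add: casimir_eq_quartic_sum X)
qed

end

theorem theorem0p3:
  fixes scale :: "'k::{alg_closed_field, field_char_0} \<Rightarrow> 'g::ab_group_add \<Rightarrow> 'g"
    and bracket :: "'g \<Rightarrow> 'g \<Rightarrow> 'g"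
    and \<sigma> :: "'g \<Rightarrow> 'g"
    and J :: "'i set" and e e' :: "'i \<Rightarrow> 'g"
    and scaleS :: "'k \<Rightarrow> 's::ab_group_add \<Rightarrow> 's"
    and c :: "'g \<Rightarrow> 's \<Rightarrow> 's"
  assumes "simple_lie_algebra scale bracket"
    and "lie_algebra.involution scale bracket \<sigma>"
    and "lie_algebra.dual_bases scale (lie_algebra.killing scale bracket) (even_part \<sigma>) J e e'"
    and "spinor_module scale scaleS (odd_part \<sigma>) (lie_algebra.killing scale bracket) c"
  shows "casimir_action J e e' (\<lambda>x. clifford_module.spin scaleS (odd_part \<sigma>) c (bracket x)) s
           = scaleS (of_nat (vector_space.dim scale (odd_part \<sigma>)) / 16) s"
proof -
  interpret L: simple_lie_algebra scale bracket by (rule assms(1))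
  interpret L: involutive_lie_algebra scale bracket \<sigma>
    by unfold_locales (fact L.finite_dim, rule assms(2))
  note nondeg = killing_nondegenerate[OF assms(1) L.involutive_lie_algebra_axioms assms(3)]
  obtain b where b: "b \<subseteq> odd_part \<sigma>" "L.independent b" "odd_part \<sigma> \<subseteq> L.span b"
      "card b = L.dim (odd_part \<sigma>)"
    by (rule L.basis_exists)
  have span_b: "L.span b = odd_part \<sigma>"
    using b(1,3) L.span_minimal[OF b(1) L.subspace_odd] by blast
  have fin_b: "finite b"
    using L.finite_dim L.independent_span_bound b(2) by blast
  obtain b' where odd_frames: "L.killing.dual_frames (odd_part \<sigma>) b (\<lambda>y. y) b'"
    using L.killing.exists_dual_frames[OF fin_b b(2)] L.killing_nondegenerate_odd[OF nondeg]
    unfolding span_b by blast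
  have delta: "L.killing (e i) (e' j) = (if i = j then 1 else 0)" if "i \<in> J" "j \<in> J" for i j
    using assms(3) that by (simp add: L.dual_bases_def)
  have delta': "L.killing (e' i) (e j) = (if i = j then 1 else 0)" if "i \<in> J" "j \<in> J" for i j
    using delta[OF that(2,1)] L.killing.B_sym[of "e' i"] by auto
  have "x = (\<Sum>j\<in>J. scale (L.killing x (e' j)) (e j))" "x = (\<Sum>j\<in>J. scale (L.killing x (e j)) (e' j))"
    if "x \<in> even_part \<sigma>" for x
    using that assms(3) delta delta'
    by (auto simp: L.dual_bases_def L.basis_family_def intro!: L.killing.expansion_in_dual_family)
  moreover have "e ` J \<subseteq> even_part \<sigma>" "e' ` J \<subseteq> even_part \<sigma>" "finite J"
    using assms(3) L.span_superset[of "e ` J"] L.span_superset[of "e' ` J"]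
    by (auto simp: L.dual_bases_def L.basis_family_def)
  ultimately have even_frames: "L.killing.dual_frames (even_part \<sigma>) J e e'"
    unfolding L.killing.dual_frames_def using delta by blast
  interpret S: spinor_module scale scaleS "odd_part \<sigma>" L.killing c by (rule assms(4))
  interpret framed_spin_symmetric_pair scale bracket \<sigma> J e e' b "\<lambda>y. y" b' scaleS c
    by unfold_locales (fact even_frames, fact odd_frames)
  show ?thesis
    unfolding casimir_action_def casimir_spin b(4) ..
qed

end
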